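(* Let $K\ge2$ and $\mathcal{I}=\{(k,l):k,l\in\{1,\dots,K\},\ k+l\le K\}$. Fix any $\delta\in(0,\pi/3)$ and $\phi,\phi'\in\mathbb{R}^K$. Denote $\Phi_{k,l}=\phi_{k+l}-\phi_k-\phi_l$ and $\Phi'_{k,l}=\phi'_{k+l}-\phi'_k-\phi'_l$. If $$|\Phi_{k,l}-\Phi'_{k,l}|_{\mathcal{A}}\le\delta\quad\text{for all }(k,l)\in\mathcal{I},$$ then there exists $\alpha\in\mathbb{R}$ such that $$|\phi_k-\phi'_k-k\alpha|_{\mathcal{A}}\le\delta\quad\text{for all }k=1,\dots,K.$$
   Context: For $x\in\mathbb{R}$, $|x|_{\mathcal{A}}=\min_{j\in\mathbb{Z}}|x+2\pi j|$ denotes the circular distance of $x$ to $0$ modulo $2\pi$. *)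

theory Defs
  imports Complex_Main
begin

definition circ_abs :: "real \<Rightarrow> real" where
  "circ_abs x = (INF j::int. \<bar>x + 2 * pi * real_of_int j\<bar>)"

text \<open>The infimum is a minimum.\<close>

lemma circ_abs_attained:
  "\<exists>j::int. circ_abs x = \<bar>x + 2 * pi * real_of_int j\<bar>"
proof -
  let ?f = "\<lambda>j::int. \<bar>x + 2 * pi * real_of_int j\<bar>"
  define r where "r = x / (2 * pi)"
  define i where "i = - round r"
  have f: "?f j = 2 * pi * \<bar>r + real_of_int j\<bar>" for j
  proof -
    have "x + 2 * pi * real_of_int j = 2 * pi * (r + real_of_int j)"
      by (simp add: r_def field_simps)
    then show ?thesis by (simp add: abs_mult)
  qed
  have "?f i \<le> ?f j" for j
    unfolding f using round_diff_minimal[of r "- j"] by (simp add: i_def)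
  then have "circ_abs x = ?f i"
    unfolding circ_abs_def by (intro cInf_eq_minimum) auto
  then show ?thesis by blast
qed

lemma circ_abs_le: "circ_abs x \<le> \<bar>x + 2 * pi * real_of_int j\<bar>"
  unfolding circ_abs_def by (rule cINF_lower) (auto intro: bdd_belowI[of _ 0])

definition index_pairs :: "nat \<Rightarrow> (nat \<times> nat) set" where
  "index_pairs K = {(k, l). k \<in> {1..K} \<and> l \<in> {1..K} \<and> k + l \<le> K}"

text \<open>A vector in \<open>\<real>\<^sup>K\<close> is a function \<open>nat \<Rightarrow> real\<close> of which only the
  entries with index in \<open>{1..K}\<close> matter.\<close>

definition phase_comb :: "(nat \<Rightarrow> real) \<Rightarrow> nat \<Rightarrow> nat \<Rightarrow> real" where
  "phase_comb \<phi> k l = \<phi> (k + l) - \<phi> k - \<phi> l"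

end

theory Submission
  imports Defs
begin

text \<open>
  Put \<open>\<psi> = \<phi> - \<phi>'\<close>. Shifting the entries of \<open>\<psi>\<close> by multiples of \<open>2\<pi>\<close>, one may assume
  \<open>\<bar>\<psi>\<^sub>k\<^sub>+\<^sub>1 - \<psi>\<^sub>k - \<psi>\<^sub>1\<bar> \<le> \<delta>\<close> as real numbers. The cocycle identity then bounds every
  \<open>\<psi>\<^sub>k\<^sub>+\<^sub>l - \<psi>\<^sub>k - \<psi>\<^sub>l\<close> inductively by \<open>3\<delta>\<close>, and since it is within \<open>\<delta>\<close> of \<open>2\<pi>\<int>\<close> and
  \<open>4\<delta> < 2\<pi>\<close>, it is bounded by \<open>\<delta>\<close>. For such an approximately additive real sequence the intervals
  \<open>[(\<psi>\<^sub>k - \<delta>)/k, (\<psi>\<^sub>k + \<delta>)/k]\<close> intersect pairwise, by a subtractive Euclidean induction on the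
  pair of indices; hence they have a common point \<open>\<alpha>\<close>.
\<close>

text \<open>Some representative of \<open>x\<close> modulo \<open>2 * pi\<close> has size at most
  \<open>\<delta>\<close>. The strict bound puts the given representative less than one period away
  from it, so the two coincide.\<close>

lemma circ_abs_liftD:
  assumes "circ_abs x \<le> \<delta>" "\<bar>x + 2 * pi * real_of_int n\<bar> + \<delta> < 2 * pi"
  shows "\<bar>x + 2 * pi * real_of_int n\<bar> \<le> \<delta>"
proof -
  obtain j where j: "\<bar>x + 2 * pi * real_of_int j\<bar> \<le> \<delta>"
    using circ_abs_attained[of x] assms(1) by auto
  have "2 * pi * \<bar>real_of_int (n - j)\<bar>
      = \<bar>(x + 2 * pi * real_of_int n) - (x + 2 * pi * real_of_int j)\<bar>"
    by (simp add: abs_mult flip: right_diff_distrib)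
  also have "\<dots> < 2 * pi * 1"
    using j assms(2) by linarith
  finally have "\<bar>real_of_int (n - j)\<bar> < 1" by simp
  then have "n = j" by linarith
  with j show ?thesis by simp
qed

text \<open>Cross-multiplied form of: the left endpoint of the interval for \<open>k\<close> is at
  most the right endpoint of the interval for \<open>l\<close>. Subtracting the smaller index from
  the larger preserves the shape of the claim.\<close>

lemma approx_additive_slopes:
  fixes \<theta> :: "nat \<Rightarrow> real"
  assumes "\<And>k l. 1 \<le> k \<Longrightarrow> 1 \<le> l \<Longrightarrow> k + l \<le> K \<Longrightarrow> \<bar>\<theta> (k + l) - \<theta> k - \<theta> l\<bar> \<le> \<delta>"
    and "0 \<le> \<delta>" "k \<in> {1..K}" "l \<in> {1..K}"
  shows "real l * (\<theta> k - \<delta>) \<le> real k * (\<theta> l + \<delta>)"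
  using assms(3,4)
proof (induction "k + l" arbitrary: k l rule: less_induct)
  case less
  consider "k = l" | "l < k" | "k < l" by linarith
  then show ?case
  proof cases
    case 1
    then show ?thesis using assms(2) by (simp add: mult_left_mono)
  next
    case 2
    define d where "d = k - l"
    with \<open>l < k\<close> have d: "k = d + l" "d \<ge> 1" by auto
    have "real l * (\<theta> d - \<delta>) \<le> real d * (\<theta> l + \<delta>)"
      using less.hyps[of d l] less.prems d by auto
    \<comment> \<open>The opposite shifts by \<open>\<delta>\<close> on the right cancel, so the
      single error from splitting \<open>k\<close> is absorbed on the left and nothing accumulates
      along the induction.\<close>
    moreover have "\<theta> k - \<delta> \<le> (\<theta> d - \<delta>) + (\<theta> l + \<delta>)"
      using assms(1)[of d l] less.prems d by auto
    then have "real l * (\<theta> k - \<delta>) \<le> real l * ((\<theta> d - \<delta>) + (\<theta> l + \<delta>))"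
      by (rule mult_left_mono) simp
    ultimately show ?thesis using d by (simp add: algebra_simps)
  next
    case 3
    define d where "d = l - k"
    with \<open>k < l\<close> have d: "l = d + k" "d \<ge> 1" by auto
    have "real d * (\<theta> k - \<delta>) \<le> real k * (\<theta> d + \<delta>)"
      using less.hyps[of k d] less.prems d by auto
    moreover have "(\<theta> d + \<delta>) + (\<theta> k - \<delta>) \<le> \<theta> l + \<delta>"
      using assms(1)[of d k] less.prems d by auto
    then have "real k * ((\<theta> d + \<delta>) + (\<theta> k - \<delta>)) \<le> real k * (\<theta> l + \<delta>)"
      by (rule mult_left_mono) simp
    ultimately show ?thesis using d by (simp add: algebra_simps)
  qed
qed

lemma approx_additive_near_linear:
  fixes \<theta> :: "nat \<Rightarrow> real"
  assumes "\<And>k l. 1 \<le> k \<Longrightarrow> 1 \<le> l \<Longrightarrow> k + l \<le> K \<Longrightarrow> \<bar>\<theta> (k + l) - \<theta> k - \<theta> l\<bar> \<le> \<delta>"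
    and "0 \<le> \<delta>" "1 \<le> K"
  shows "\<exists>\<alpha>. \<forall>k\<in>{1..K}. \<bar>\<theta> k - real k * \<alpha>\<bar> \<le> \<delta>"
proof (intro exI ballI)
  \<comment> \<open>The witness for \<alpha> is \<open>Max S\<close>, the largest left endpoint. By
    pairwise intersection it lies below every right endpoint.\<close>
  define S where "S = (\<lambda>k. (\<theta> k - \<delta>) / real k) ` {1..K}"
  have S: "finite S" "S \<noteq> {}" using assms(3) by (auto simp: S_def)
  fix k assume k: "k \<in> {1..K}"
  have "(\<theta> k - \<delta>) / real k \<le> Max S"
    using S k by (intro Max_ge) (auto simp: S_def)
  then have "\<theta> k - \<delta> \<le> real k * Max S"
    using k by (simp add: divide_le_eq mult.commute)
  moreover have "(\<theta> i - \<delta>) / real i \<le> (\<theta> k + \<delta>) / real k" if "i \<in> {1..K}" for i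
    using approx_additive_slopes[OF assms(1,2) that k] that k
    by (simp add: divide_le_eq le_divide_eq mult.commute)
  then have "Max S \<le> (\<theta> k + \<delta>) / real k"
    using S by (auto simp: S_def)
  then have "real k * Max S \<le> \<theta> k + \<delta>"
    using k by (simp add: le_divide_eq mult.commute)
  ultimately show "\<bar>\<theta> k - real k * Max S\<bar> \<le> \<delta>" by linarith
qed

text \<open>The pairs \<open>(k, 1)\<close> determine the shifts recursively; induction on
  \<open>l\<close> carries the bound to all other pairs without further choices.\<close>

lemma circ_approx_additive_lift:
  fixes \<psi> :: "nat \<Rightarrow> real"
  assumes psi: "\<And>k l. 1 \<le> k \<Longrightarrow> 1 \<le> l \<Longrightarrow> k + l \<le> K \<Longrightarrow> circ_abs (phase_comb \<psi> k l) \<le> \<delta>"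
    and "4 * \<delta> < 2 * pi"
  shows "\<exists>m :: nat \<Rightarrow> int. \<forall>k\<ge>1. \<forall>l\<ge>1. k + l \<le> K \<longrightarrow>
    \<bar>phase_comb (\<lambda>i. \<psi> i + 2 * pi * real_of_int (m i)) k l\<bar> \<le> \<delta>"
proof -
  obtain j :: "nat \<Rightarrow> int"
    where j: "\<And>k. circ_abs (phase_comb \<psi> k 1) = \<bar>phase_comb \<psi> k 1 + 2 * pi * real_of_int (j k)\<bar>"
    using circ_abs_attained[of "phase_comb \<psi> _ 1"] by metis
  \<comment> \<open>This solves \<open>m (k + 1) - m k - m 1 = j k\<close> for
    \<open>k \<ge> 1\<close>, with \<open>m 1 = 0\<close> as an empty sum.\<close>
  define m where "m k = (\<Sum>i\<in>{1..<k}. j i)" for k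
  define \<theta> where "\<theta> = (\<lambda>i. \<psi> i + 2 * pi * real_of_int (m i))"
  have unit_step: "\<bar>phase_comb \<theta> k 1\<bar> \<le> \<delta>" if "1 \<le> k" "k + 1 \<le> K" for k
  proof -
    have "phase_comb \<theta> k 1 = phase_comb \<psi> k 1 + 2 * pi * real_of_int (j k)"
      using that by (simp add: phase_comb_def \<theta>_def m_def algebra_simps)
    then show ?thesis using j[of k] psi[of k 1] that by simp
  qed
  have "\<bar>phase_comb \<theta> k l\<bar> \<le> \<delta>" if "1 \<le> l" "1 \<le> k" "k + l \<le> K" for k l
    using that
  proof (induction l rule: dec_induct)
    case base
    then show ?case using unit_step by simp
  next
    case (step l)
    \<comment> \<open>Cocycle identity: three terms of size at most \<open>\<delta>\<close>, one
      from the induction hypothesis and two unit steps. The resulting \<open>3 * \<delta>\<close> is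
      cut back to \<open>\<delta>\<close> by \<open>circ_abs_liftD\<close>.\<close>
    have "phase_comb \<theta> k (Suc l) = phase_comb \<theta> k l + phase_comb \<theta> (k + l) 1 - phase_comb \<theta> l 1"
      by (simp add: phase_comb_def)
    moreover have "\<bar>phase_comb \<theta> k l\<bar> \<le> \<delta>" "\<bar>phase_comb \<theta> (k + l) 1\<bar> \<le> \<delta>" "\<bar>phase_comb \<theta> l 1\<bar> \<le> \<delta>"
      using step unit_step by auto
    ultimately have "\<bar>phase_comb \<theta> k (Suc l)\<bar> + \<delta> < 2 * pi"
      using assms(2) by linarith
    moreover have "phase_comb \<theta> k (Suc l) = phase_comb \<psi> k (Suc l)
        + 2 * pi * real_of_int (m (k + Suc l) - m k - m (Suc l))"
      by (simp add: phase_comb_def \<theta>_def algebra_simps)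
    ultimately show ?case
      using circ_abs_liftD[OF psi[of k "Suc l"]] step.prems by (metis le_add1 plus_1_eq_Suc)
  qed
  then show ?thesis unfolding \<theta>_def by blast
qed

theorem lemma4p9:
  fixes K :: nat and \<delta> :: real and \<phi> \<phi>' :: "nat \<Rightarrow> real"
  assumes "2 \<le> K"
    and "\<delta> \<in> {0<..<pi / 3}"
    and "\<forall>(k, l) \<in> index_pairs K. circ_abs (phase_comb \<phi> k l - phase_comb \<phi>' k l) \<le> \<delta>"
  shows "\<exists>\<alpha>::real. \<forall>k \<in> {1..K}. circ_abs (\<phi> k - \<phi>' k - real k * \<alpha>) \<le> \<delta>"
proof -
  define \<psi> where "\<psi> = (\<lambda>k. \<phi> k - \<phi>' k)"
  have "circ_abs (phase_comb \<psi> k l) \<le> \<delta>" if "1 \<le> k" "1 \<le> l" "k + l \<le> K" for k l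
  proof -
    have "phase_comb \<psi> k l = phase_comb \<phi> k l - phase_comb \<phi>' k l"
      by (simp add: \<psi>_def phase_comb_def)
    moreover have "(k, l) \<in> index_pairs K" using that by (auto simp: index_pairs_def)
    ultimately show ?thesis using assms(3) by auto
  qed
  moreover have "4 * \<delta> < 2 * pi" using assms(2) pi_gt_zero
    unfolding greaterThanLessThan_iff by linarith
  ultimately have "\<exists>m :: nat \<Rightarrow> int. \<forall>k\<ge>1. \<forall>l\<ge>1. k + l \<le> K \<longrightarrow>
      \<bar>phase_comb (\<lambda>i. \<psi> i + 2 * pi * real_of_int (m i)) k l\<bar> \<le> \<delta>"
    by (rule circ_approx_additive_lift)
  then obtain m :: "nat \<Rightarrow> int" where m: "\<And>k l. 1 \<le> k \<Longrightarrow> 1 \<le> l \<Longrightarrow> k + l \<le> K \<Longrightarrow>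
      \<bar>phase_comb (\<lambda>i. \<psi> i + 2 * pi * real_of_int (m i)) k l\<bar> \<le> \<delta>"
    by blast
  obtain \<alpha> where \<alpha>: "\<forall>k\<in>{1..K}. \<bar>\<psi> k + 2 * pi * real_of_int (m k) - real k * \<alpha>\<bar> \<le> \<delta>"
    using approx_additive_near_linear[of K "\<lambda>i. \<psi> i + 2 * pi * real_of_int (m i)" \<delta>]
      m[unfolded phase_comb_def] assms(1,2) by auto
  \<comment> \<open>The shift \<open>m k\<close> is one of the candidates in the minimum over the
    integers.\<close>
  have "circ_abs (\<phi> k - \<phi>' k - real k * \<alpha>) \<le> \<delta>" if "k \<in> {1..K}" for k
    using bspec[OF \<alpha> that] circ_abs_le[of "\<phi> k - \<phi>' k - real k * \<alpha>" "m k"]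
    by (simp add: \<psi>_def algebra_simps)
  then show ?thesis by blast
qed

end
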